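(* Consider the problem of minimizing $f=\sum_{i=1}^m f_i$ over $X$, and suppose that Assumption 1 (common optimal solution) and Assumption 2 (Hölder condition of order $p>0$) stated in the context hold. Let $\{x_k\}$ be a sequence generated by the randomized incremental subgradient method described in the context with the diminishing stepsize rule, i.e. $v_k>0$, $\lim_{k\to\infty}v_k=0$ and $\sum_{k=0}^\infty v_k=\infty$. Then $\liminf_{k\to\infty}f(x_k)=f^*$ with probability 1.
   Context: Setting. $X\subseteq\mathbb{R}^n$ is nonempty, closed and convex, and $f_1,\dots,f_m:\mathbb{R}^n\to\mathbb{R}$ are continuous and quasi-convex (a function $h$ is quasi-convex if $h((1-\alpha)x+\alpha y)\le\max\{h(x),h(y)\}$ for all $x,y\in\mathbb{R}^n$, $\alpha\in[0,1]$). Put $f:=\sum_{i=1}^m f_i$ ($f$ need not be quasi-convex), $f^*:=\min_{x\in X}f(x)$, $X^*:=\arg\min_{x\in X}f(x)$, $f_i^*:=\min_{x\in X}f_i(x)$, $X_i^*:=\arg\min_{x\in X}f_i(x)$. The index $k$ ranges over $\{0,1,2,\dots\}$; $\|\cdot\|$ is the Euclidean norm, $P_X$ the Euclidean projection onto $X$, and $S(0,1)$ the unit sphere. Assumption 1. The component functions have a common optimal solution over $X$ (equivalently $X^*=\bigcap_{i=1}^m X_i^*\neq\emptyset$). Assumption 2. $p>0$, $L_i>0$ for $i=1,\dots,m$, and for each $i$, $|f_i(y)-f_i(x)|\le L_i\|y-x\|^p$ for all $x\in X$ and all $y\in\mathbb{R}^n$. Quasi-subdifferential. For quasi-convex $h:\mathbb{R}^n\to\mathbb{R}$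 and $x\in\mathbb{R}^n$, $\partial h(x):=\{g:\langle g,y-x\rangle\le 0\text{ for every } y \text{ with } h(y)<h(x)\}$. Randomized incremental subgradient method. Initialize an initial point $x_0\in\mathbb{R}^n$, a stepsize sequence $\{v_k\}$, and $k:=0$. While $f(x_k)>f^*$: let $I_k:=\{i\in\{1,\dots,m\}:f_i(x_k)>f_i^*\}$; pick equiprobably a random variable $\omega_k$ from the set $I_k$, calculate $g_{k,\omega_k}\in\partial f_{\omega_k}(x_k)\cap S(0,1)$, and set $x_{k+1}:=P_X(x_k-v_kg_{k,\omega_k})$; then $k:=k+1$.
   Formalization: The formal theorem additionally assumes f(x_0) ≥ f^*, automatic when x_0 lies in X; if an infeasible x_0 has f(x_0) < f^*, the method stops at once and the claim is undefined or false. Runs that stop are continued with a constant iterate. *)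

theory Defs
  imports "HOL-Probability.Probability"
begin

definition quasi_convex :: "('a::real_vector \<Rightarrow> real) \<Rightarrow> bool" where
  "quasi_convex h \<longleftrightarrow>
     (\<forall>x y. \<forall>\<alpha>\<in>{0..1}. h ((1 - \<alpha>) *\<^sub>R x + \<alpha> *\<^sub>R y) \<le> max (h x) (h y))"

definition quasi_subdiff :: "('a::real_inner \<Rightarrow> real) \<Rightarrow> 'a \<Rightarrow> 'a set" where
  "quasi_subdiff h x = {g. \<forall>y. h y < h x \<longrightarrow> g \<bullet> (y - x) \<le> 0}"

text \<open>The infimum is meant as a minimum; it is only used where a minimizer over \<open>X\<close> exists.\<close>

definition min_value :: "('a \<Rightarrow> real) \<Rightarrow> 'a set \<Rightarrow> real" where
  "min_value h X = (INF x\<in>X. h x)"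

definition argmin_set :: "('a \<Rightarrow> real) \<Rightarrow> 'a set \<Rightarrow> 'a set" where
  "argmin_set h X = {x. is_arg_min h (\<lambda>y. y \<in> X) x}"

definition sum_fun :: "nat \<Rightarrow> (nat \<Rightarrow> 'a \<Rightarrow> real) \<Rightarrow> 'a \<Rightarrow> real" where
  "sum_fun m f x = (\<Sum>i=1..m. f i x)"

definition holder_condition ::
  "nat \<Rightarrow> (nat \<Rightarrow> 'a::real_normed_vector \<Rightarrow> real) \<Rightarrow> 'a set \<Rightarrow> (nat \<Rightarrow> real) \<Rightarrow> real \<Rightarrow> bool" where
  "holder_condition m f X L p \<longleftrightarrow>
     p > 0 \<and>
     (\<forall>i\<in>{1..m}. L i > 0 \<and>
        (\<forall>x\<in>X. \<forall>y. \<bar>f i y - f i x\<bar> \<le> L i * norm (y - x) powr p))"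

definition active_indices ::
  "nat \<Rightarrow> (nat \<Rightarrow> 'a \<Rightarrow> real) \<Rightarrow> 'a set \<Rightarrow> 'a \<Rightarrow> nat set" where
  "active_indices m f X x = {i\<in>{1..m}. f i x > min_value (f i) X}"

text \<open>
  The sigma-algebra \<open>F k\<close> is the information available when \<open>\<omega> k\<close> is drawn. It may be
  the one generated by the iterates \<open>x 0, \<dots>, x k\<close> or any larger history, such as one that
  also contains the earlier indices and subgradients. Drawing \<open>\<omega> k\<close> equiprobably from the
  active indices means that its conditional distribution given \<open>F k\<close> is uniform on that
  (random) set. The vector \<open>g k w\<close> is the subgradient of the component \<open>\<omega> k w\<close> chosen
  at step \<open>k\<close>, by any rule.

  Once the test \<open>f (x k) > f\<^sup>*\<close> of the while-loop fails, the iterate is kept forever, so that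
  a run that stops is represented by an infinite sequence as well; \<open>\<omega> k\<close> and \<open>g k\<close>
  are then irrelevant and unconstrained.
\<close>

locale randomized_incremental_subgradient =
  prob_space M + filtration "space M" F
  for M :: "'w measure" and F :: "nat \<Rightarrow> 'w measure" +
  fixes m :: nat
    and f :: "nat \<Rightarrow> 'a::euclidean_space \<Rightarrow> real"
    and X :: "'a set"
    and v :: "nat \<Rightarrow> real"
    and x0 :: 'a
    and x :: "nat \<Rightarrow> 'w \<Rightarrow> 'a"
    and \<omega> :: "nat \<Rightarrow> 'w \<Rightarrow> nat"
    and g :: "nat \<Rightarrow> 'w \<Rightarrow> 'a"
  assumes subalgebra_F: "subalgebra M (F k)"
    and adapted: "x k \<in> borel_measurable (F k)"
    and index_measurable: "\<omega> k \<in> measurable M (count_space UNIV)"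
    and initial: "w \<in> space M \<Longrightarrow> x 0 w = x0"
    and index_active:
      "w \<in> space M \<Longrightarrow> sum_fun m f (x k w) > min_value (sum_fun m f) X
         \<Longrightarrow> \<omega> k w \<in> active_indices m f X (x k w)"
    and index_uniform:
      "AE w in M. sum_fun m f (x k w) > min_value (sum_fun m f) X \<longrightarrow>
         (\<forall>i\<in>active_indices m f X (x k w).
            real_cond_exp M (F k) (indicat_real {w\<in>space M. \<omega> k w = i}) w
              = 1 / real (card (active_indices m f X (x k w))))"
    and subgradient:
      "w \<in> space M \<Longrightarrow> sum_fun m f (x k w) > min_value (sum_fun m f) X
         \<Longrightarrow> g k w \<in> quasi_subdiff (f (\<omega> k w)) (x k w) \<inter> sphere 0 1"
    and step:
      "w \<in> space M \<Longrightarrow> sum_fun m f (x k w) > min_value (sum_fun m f) X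
         \<Longrightarrow> x (Suc k) w = closest_point X (x k w - v k *\<^sub>R g k w)"
    and stopped:
      "w \<in> space M \<Longrightarrow> \<not> sum_fun m f (x k w) > min_value (sum_fun m f) X
         \<Longrightarrow> x (Suc k) w = x k w"

end

theory Submission
  imports Defs
begin

text \<open>
  The proof is a stopped Lyapunov argument for the squared distance \<open>d k\<close> from \<open>x k\<close> to one fixed
  common minimizer \<open>z\<close> of all the components over \<open>X\<close>.

  The Hoelder condition turns a value gap into a margin: if \<open>f i\<close> exceeds its minimum at \<open>x k\<close> by
  more than \<open>L i * c powr p\<close>, then a whole ball of radius \<open>c\<close> around \<open>z\<close> lies in the strict sublevel
  set of \<open>f i\<close> at \<open>x k\<close>, so that a unit quasi-subgradient makes an inner product of at least \<open>c\<close>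
  with \<open>x k - z\<close> (lemma \<open>quasi_subdiff_margin\<close>). As the projection is nonexpansive, the step along
  it gives \<open>d (Suc k) \<le> d k - 2 * v k * c + (v k)\<^sup>2\<close>; for every active component the inequality at
  least holds with \<open>c = 0\<close>.

  While the objective stays \<open>\<epsilon>\<close> above its minimum, some component has a gap of \<open>\<epsilon> / m\<close>, and this
  component is drawn with conditional probability at least \<open>1 / m\<close>. Once \<open>v k \<le> c / m\<close>, the
  integral of \<open>d\<close> over an event of the past on which the gap is at least \<open>\<epsilon>\<close> therefore drops by at
  least \<open>c / m * v k\<close> times the probability of that event (lemma \<open>expected_descent\<close>).

  Let \<open>N\<close> be so large that the steps are small in this sense from \<open>N\<close> on, and let \<open>A n\<close> be the
  event that the gap is at least \<open>\<epsilon>\<close> from time \<open>N\<close> to time \<open>n\<close>. The \<open>A n\<close> decrease and the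
  integral of \<open>d n\<close> over \<open>A n\<close> is nonnegative, so telescoping bounds \<open>\<Sum> v k * prob (A k)\<close>. Since
  \<open>\<Sum> v k\<close> diverges, the intersection of the \<open>A n\<close> is null (lemma \<open>persistent_gap_null\<close>). The
  union of these null events over \<open>N\<close> and over \<open>\<epsilon> = 1 / Suc j\<close> is the event that the lower limit
  exceeds the minimum.
\<close>

section \<open>Quasi-subgradient steps\<close>

text \<open>
  The witness is the point at distance \<open>c\<close> from \<open>z\<close> in the direction \<open>g\<close>: it still has a value
  below \<open>h x\<close>, so it lies in the half-space \<open>g \<bullet> (y - x) \<le> 0\<close>. The strict gap makes \<open>c = 0\<close> a
  useful case, namely \<open>h z < h x\<close> without a rate.
\<close>

lemma quasi_subdiff_margin:
  fixes h :: "'a::real_inner \<Rightarrow> real"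
  assumes holder: "\<And>y. \<bar>h y - h z\<bar> \<le> L * norm (y - z) powr p"
    and g: "g \<in> quasi_subdiff h x" "norm g = 1"
    and "0 \<le> c" and gap: "L * c powr p < h x - h z"
  shows "c \<le> g \<bullet> (x - z)"
proof -
  have "\<bar>h (z + c *\<^sub>R g) - h z\<bar> \<le> L * c powr p"
    using holder[of "z + c *\<^sub>R g"] g(2) \<open>0 \<le> c\<close> by simp
  with gap have "h (z + c *\<^sub>R g) < h x" by linarith
  with g(1) have "g \<bullet> (z + c *\<^sub>R g - x) \<le> 0"
    by (auto simp: quasi_subdiff_def)
  moreover have "g \<bullet> g = 1"
    using g(2) by (simp add: dot_square_norm)
  ultimately show ?thesis
    by (simp add: inner_diff_right inner_add_right)
qed

lemma projected_step_sq_dist_le: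
  fixes X :: "'a::euclidean_space set"
  assumes "convex X" "closed X" "z \<in> X"
    and "norm g = 1" "0 \<le> v" "c \<le> g \<bullet> (x - z)"
  shows "(norm (closest_point X (x - v *\<^sub>R g) - z))\<^sup>2 \<le> (norm (x - z))\<^sup>2 - 2 * v * c + v\<^sup>2"
proof -
  have "norm (closest_point X (x - v *\<^sub>R g) - z) \<le> norm (x - v *\<^sub>R g - z)"
    using closest_point_lipschitz[of X "x - v *\<^sub>R g" z] assms(1-3)
    by (auto simp: closest_point_self dist_norm)
  hence "(norm (closest_point X (x - v *\<^sub>R g) - z))\<^sup>2 \<le> (norm (x - z - v *\<^sub>R g))\<^sup>2"
    by (simp add: algebra_simps power_mono)
  also have "\<dots> = (norm (x - z))\<^sup>2 - 2 * v * (g \<bullet> (x - z)) + v\<^sup>2"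
    using \<open>norm g = 1\<close> dot_norm_neg[of "x - z" "v *\<^sub>R g"]
    by (simp add: inner_commute power_mult_distrib field_simps)
  also have "\<dots> \<le> (norm (x - z))\<^sup>2 - 2 * v * c + v\<^sup>2"
    using assms(5,6) by (simp add: mult_left_mono)
  finally show ?thesis .
qed

lemma min_value_eqI:
  assumes "z \<in> X" "\<And>y. y \<in> X \<Longrightarrow> h z \<le> h y"
  shows "min_value h X = h z"
  unfolding min_value_def using assms by (intro cInf_eq_minimum) auto

section \<open>Descent along a run\<close>

locale subgradient_run_with_common_minimizer =
  randomized_incremental_subgradient M F m f X v x0 x \<omega> g
  for M :: "'w measure" and F :: "nat \<Rightarrow> 'w measure" and m :: nat
    and f :: "nat \<Rightarrow> 'a::euclidean_space \<Rightarrow> real" and X :: "'a set" and v :: "nat \<Rightarrow> real"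
    and x0 :: 'a and x :: "nat \<Rightarrow> 'w \<Rightarrow> 'a" and \<omega> :: "nat \<Rightarrow> 'w \<Rightarrow> nat"
    and g :: "nat \<Rightarrow> 'w \<Rightarrow> 'a" +
  fixes L :: "nat \<Rightarrow> real" and p :: real and z :: 'a
  assumes closed_X: "closed X" and convex_X: "convex X"
    and continuous_f: "i \<in> {1..m} \<Longrightarrow> continuous_on UNIV (f i)"
    and holder: "holder_condition m f X L p"
    and v_pos: "v k > 0"
    and z_in_X: "z \<in> X"
    and z_minimal: "i \<in> {1..m} \<Longrightarrow> y \<in> X \<Longrightarrow> f i z \<le> f i y"
    and x0_above: "min_value (sum_fun m f) X \<le> sum_fun m f x0"
begin

abbreviation sq_dist :: "nat \<Rightarrow> 'w \<Rightarrow> real" where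
  "sq_dist k w \<equiv> (norm (x k w - z))\<^sup>2"

lemma min_value_component: "i \<in> {1..m} \<Longrightarrow> min_value (f i) X = f i z"
  using z_in_X z_minimal by (intro min_value_eqI) auto

lemma min_value_objective: "min_value (sum_fun m f) X = sum_fun m f z"
  unfolding sum_fun_def using z_in_X z_minimal by (intro min_value_eqI sum_mono) auto

text \<open>
  The start may lie outside \<open>X\<close>, where a value below the minimum is conceivable; every iterate that
  differs from it is a projection onto \<open>X\<close>.
\<close>

lemma objective_ge_min:
  assumes "w \<in> space M"
  shows "sum_fun m f z \<le> sum_fun m f (x k w)"
proof (induction k)
  case 0
  then show ?case using x0_above initial[OF assms] by (simp add: min_value_objective)
next
  case (Suc k)
  show ?case
  proof (cases "sum_fun m f (x k w) > min_value (sum_fun m f) X")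
    case True
    then have "x (Suc k) w \<in> X"
      using step[OF assms] closed_X z_in_X by (auto intro!: closest_point_in_set)
    then show ?thesis
      unfolding sum_fun_def using z_minimal by (intro sum_mono) auto
  next
    case False
    then show ?thesis using stopped[OF assms] Suc by simp
  qed
qed

lemma sq_dist_descent:
  assumes w: "w \<in> space M" and above: "sum_fun m f z < sum_fun m f (x k w)"
    and "0 \<le> c" and gap: "L (\<omega> k w) * c powr p < f (\<omega> k w) (x k w) - f (\<omega> k w) z"
  shows "sq_dist (Suc k) w \<le> sq_dist k w - 2 * v k * c + (v k)\<^sup>2"
proof -
  have above': "min_value (sum_fun m f) X < sum_fun m f (x k w)"
    using above by (simp add: min_value_objective)
  have i: "\<omega> k w \<in> {1..m}"
    using index_active[OF w above'] by (simp add: active_indices_def)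
  have g: "g k w \<in> quasi_subdiff (f (\<omega> k w)) (x k w)" "norm (g k w) = 1"
    using subgradient[OF w above'] by auto
  have "c \<le> g k w \<bullet> (x k w - z)"
    using holder i z_in_X g \<open>0 \<le> c\<close> gap
    by (intro quasi_subdiff_margin[where L = "L (\<omega> k w)" and p = p])
      (auto simp: holder_condition_def)
  with g(2) v_pos[of k] show ?thesis
    using projected_step_sq_dist_le[OF convex_X closed_X z_in_X] step[OF w above'] by simp
qed

lemma sq_dist_Suc_le:
  assumes w: "w \<in> space M"
  shows "sq_dist (Suc k) w \<le> sq_dist k w + (v k)\<^sup>2"
proof (cases "sum_fun m f z < sum_fun m f (x k w)")
  case True
  then have "\<omega> k w \<in> active_indices m f X (x k w)"
    using index_active[OF w] by (simp add: min_value_objective)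
  then have "f (\<omega> k w) z < f (\<omega> k w) (x k w)"
    by (auto simp: active_indices_def min_value_component)
  then show ?thesis
    using sq_dist_descent[OF w True, of 0] by simp
next
  case False
  then show ?thesis using stopped[OF w] by (simp add: min_value_objective)
qed

text \<open>The start is deterministic, so the distances are bounded at each time and hence integrable.\<close>

lemma sq_dist_bounded:
  assumes "w \<in> space M"
  shows "sq_dist k w \<le> (norm (x0 - z))\<^sup>2 + (\<Sum>j<k. (v j)\<^sup>2)"
proof (induction k)
  case 0
  then show ?case using initial[OF assms] by simp
next
  case (Suc k)
  then show ?case using sq_dist_Suc_le[OF assms, of k] by simp
qed

section \<open>Measurability and the random index\<close>

lemma sets_F_subset: "sets (F k) \<subseteq> sets M"
  using subalgebra_F[of k] by (simp add: subalgebra_def)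

lemma iterate_measurable_F:
  assumes "k \<le> n"
  shows "x k \<in> borel_measurable (F n)"
  using adapted[of k] sets_F_mono[OF assms] by (auto simp: measurable_def space_F)

lemma iterate_measurable: "x k \<in> borel_measurable M"
  using measurable_from_subalg[OF subalgebra_F adapted] .

lemma component_measurable:
  assumes "i \<in> {1..m}"
  shows "f i \<in> borel_measurable borel"
  using continuous_f[OF assms] by (rule borel_measurable_continuous_onI)

lemma objective_measurable: "sum_fun m f \<in> borel_measurable borel"
proof -
  have "(\<lambda>y. \<Sum>i=1..m. f i y) \<in> borel_measurable borel"
    by (intro borel_measurable_sum component_measurable)
  then show ?thesis by (simp add: sum_fun_def[abs_def])
qed

lemma integrable_sq_dist: "integrable M (sq_dist k)"
  using iterate_measurable sq_dist_bounded
  by (intro integrable_const_bound[where B = "(norm (x0 - z))\<^sup>2 + (\<Sum>j<k. (v j)\<^sup>2)"]) auto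

text \<open>
  Since at most \<open>m\<close> components are active, each of them is drawn with conditional probability at
  least \<open>1 / m\<close>; integrating over an event of the past removes the conditional expectation.
\<close>

lemma prob_active_index_ge:
  assumes B: "B \<in> sets (F k)"
    and above: "\<And>w. w \<in> B \<Longrightarrow> sum_fun m f z < sum_fun m f (x k w)"
    and active: "\<And>w. w \<in> B \<Longrightarrow> i \<in> active_indices m f X (x k w)"
  shows "prob B / m \<le> prob (B \<inter> {w\<in>space M. \<omega> k w = i})"
proof -
  interpret S: finite_measure_subalgebra M "F k"
    by unfold_locales (rule subalgebra_F)
  let ?J = "{w\<in>space M. \<omega> k w = i}"
  have BM [measurable]: "B \<in> sets M" using B sets_F_subset by auto
  note index_measurable[of k, measurable]
  have J [measurable]: "?J \<in> sets M" by measurable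
  have int: "integrable M (indicat_real ?J)" by (simp add: less_top[symmetric])
  have int_cond: "integrable M (real_cond_exp M (F k) (indicat_real ?J))"
    using S.real_cond_exp_int(1)[OF int] .
  have "prob B / m = (\<integral>w. indicat_real B w * (1 / m) \<partial>M)" by simp
  also have "\<dots> \<le> (\<integral>w. indicat_real B w * real_cond_exp M (F k) (indicat_real ?J) w \<partial>M)"
  proof (rule integral_mono_AE)
    show "integrable M (\<lambda>w. indicat_real B w * (1 / m))"
      by (intro integrable_mult_left) (simp add: less_top[symmetric])
    show "integrable M (\<lambda>w. indicat_real B w * real_cond_exp M (F k) (indicat_real ?J) w)"
      using integrable_mult_indicator[OF BM int_cond] by simp
    show "AE w in M. indicat_real B w * (1 / m)
            \<le> indicat_real B w * real_cond_exp M (F k) (indicat_real ?J) w"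
      using index_uniform[of k]
    proof eventually_elim
      case (elim w)
      show ?case
      proof (cases "w \<in> B")
        case True
        let ?I = "active_indices m f X (x k w)"
        have I: "?I \<subseteq> {1..m}" by (auto simp: active_indices_def)
        then have "card ?I \<le> m" using card_mono[OF finite_atLeastAtMost I] by simp
        moreover have "0 < card ?I"
          using active[OF True] finite_subset[OF I] by (auto simp: card_gt_0_iff)
        ultimately have "1 / real m \<le> 1 / real (card ?I)"
          by (simp add: frac_le)
        then show ?thesis
          using elim above[OF True] active[OF True] True by (simp add: min_value_objective)
      qed simp
    qed
  qed
  also have "\<dots> = (\<integral>w. indicat_real B w * indicat_real ?J w \<partial>M)"
    using S.real_cond_exp_intA[OF int B] by (simp add: set_lebesgue_integral_def)
  also have "\<dots> = (\<integral>w. indicat_real (B \<inter> ?J) w \<partial>M)"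
    by (simp only: indicator_inter_arith)
  also have "\<dots> = prob (B \<inter> ?J)"
    using J by simp
  finally show ?thesis .
qed

section \<open>Expected descent and the lower limit\<close>

text \<open>
  At each point of \<open>A\<close> some component has a gap of at least \<open>\<epsilon> / m\<close>. On the event \<open>B i \<inter> J i\<close> that
  component \<open>i\<close> has such a gap and is also the one drawn, the margin \<open>c\<close> is available; everywhere
  else on \<open>A\<close> the distance grows by at most \<open>(v n)\<^sup>2\<close>. The events \<open>B i \<inter> J i\<close> have total probability
  at least \<open>prob A / m\<close>, which leaves \<open>2 * v n * c / m - (v n)\<^sup>2 \<ge> c / m * v n\<close>.
\<close>

lemma expected_descent:
  assumes A: "A \<in> sets (F n)"
    and "\<epsilon> > 0" and above: "\<And>w. w \<in> A \<Longrightarrow> sum_fun m f z + \<epsilon> \<le> sum_fun m f (x n w)"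
    and "0 \<le> c" and margin: "\<And>i. i \<in> {1..m} \<Longrightarrow> L i * c powr p < \<epsilon> / m"
    and small_step: "v n \<le> c / m"
  shows "(LINT w:A|M. sq_dist (Suc n) w) + c / m * v n * prob A \<le> (LINT w:A|M. sq_dist n w)"
proof -
  define B where "B i = {w\<in>A. \<epsilon> / m \<le> f i (x n w) - f i z}" for i
  define J where "J i = {w\<in>space M. \<omega> n w = i}" for i
  define S where "S w = (\<Sum>i=1..m. indicat_real (B i \<inter> J i) w)" for w
  have AM: "A \<in> sets M" using A sets_F_subset by auto
  have A_space: "A \<subseteq> space M" using sets.sets_into_space[OF AM] .
  have B: "B i \<in> sets (F n)" if "i \<in> {1..m}" for i
  proof -
    have [measurable]: "(\<lambda>w. f i (x n w)) \<in> borel_measurable (F n)"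
      using measurable_compose[OF adapted component_measurable[OF that]] .
    have "B i = A \<inter> {w\<in>space (F n). \<epsilon> / m \<le> f i (x n w) - f i z}"
      using A_space by (auto simp: B_def space_F)
    also have "\<dots> \<in> sets (F n)" using A by measurable
    finally show ?thesis .
  qed
  note index_measurable[of n, measurable]
  have J: "J i \<in> sets M" for i unfolding J_def by measurable
  have BM: "B i \<in> sets M" if "i \<in> {1..m}" for i
    using B[OF that] sets_F_subset[of n] by (rule subsetD[rotated])
  have BJ: "B i \<inter> J i \<in> sets M" if "i \<in> {1..m}" for i
    using BM[OF that] J by (rule sets.Int)
  have m_pos: "0 < real m" if "w \<in> A" for w
    using above[OF that] \<open>\<epsilon> > 0\<close> by (cases "m = 0") (auto simp: sum_fun_def)
  have gap_exists: "\<exists>i\<in>{1..m}. w \<in> B i" if "w \<in> A" for w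
  proof (rule ccontr)
    assume "\<not> ?thesis"
    then have *: "f i (x n w) - f i z < \<epsilon> / m" if "i \<in> {1..m}" for i
      using that \<open>w \<in> A\<close> by (auto simp: B_def not_le)
    have "(\<Sum>i=1..m. f i (x n w) - f i z) < (\<Sum>i=1..m. \<epsilon> / m)"
      using m_pos[OF \<open>w \<in> A\<close>] by (intro sum_strict_mono *) auto
    also have "\<dots> = \<epsilon>" using m_pos[OF \<open>w \<in> A\<close>] by simp
    finally show False
      using above[OF \<open>w \<in> A\<close>] by (simp add: sum_fun_def sum_subtractf)
  qed
  have prob_BJ: "prob A / m \<le> (\<Sum>i=1..m. prob (B i \<inter> J i))"
  proof -
    have "A \<subseteq> (\<Union>i\<in>{1..m}. B i)" using gap_exists by auto
    then have "prob A \<le> prob (\<Union>i\<in>{1..m}. B i)"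
      using BM by (intro finite_measure_mono sets.finite_UN) auto
    also have "\<dots> \<le> (\<Sum>i=1..m. prob (B i))"
      using BM by (intro finite_measure_subadditive_finite) auto
    finally have "prob A / m \<le> (\<Sum>i=1..m. prob (B i) / m)"
      by (simp add: divide_right_mono flip: sum_divide_distrib)
    also have "\<dots> \<le> (\<Sum>i=1..m. prob (B i \<inter> J i))"
      unfolding J_def
    proof (intro sum_mono prob_active_index_ge B)
      fix i w assume i: "i \<in> {1..m}" and w: "w \<in> B i"
      then have "w \<in> A" by (auto simp: B_def)
      then show "sum_fun m f z < sum_fun m f (x n w)"
        using above \<open>\<epsilon> > 0\<close> by force
      have "0 < \<epsilon> / m" using m_pos[OF \<open>w \<in> A\<close>] \<open>\<epsilon> > 0\<close> by simp
      then show "i \<in> active_indices m f X (x n w)"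
        using i w by (auto simp: active_indices_def min_value_component B_def)
    qed
    finally show ?thesis .
  qed
  have pathwise: "indicat_real A w * sq_dist (Suc n) w
      \<le> indicat_real A w * (sq_dist n w + (v n)\<^sup>2) - 2 * v n * c * S w" for w
  proof (cases "w \<in> A")
    case False
    then have "S w = 0" by (auto simp: S_def B_def)
    with False show ?thesis by simp
  next
    case True
    then have w: "w \<in> space M" using A_space by auto
    have gt: "sum_fun m f z < sum_fun m f (x n w)"
      using above[OF True] \<open>\<epsilon> > 0\<close> by simp
    then have i: "\<omega> n w \<in> {1..m}"
      using index_active[OF w] by (auto simp: min_value_objective active_indices_def)
    \<comment> \<open>Only the index that is drawn contributes to \<open>S w\<close>.\<close>
    have "S w = (\<Sum>j=1..m. if j = \<omega> n w then indicat_real (B j) w else 0)"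
      unfolding S_def by (intro sum.cong) (auto simp: J_def w indicator_def)
    also have "\<dots> = indicat_real (B (\<omega> n w)) w"
      using i by simp
    finally have S: "S w = indicat_real (B (\<omega> n w)) w" .
    show ?thesis
    proof (cases "w \<in> B (\<omega> n w)")
      case drawn: True
      then have "L (\<omega> n w) * c powr p < f (\<omega> n w) (x n w) - f (\<omega> n w) z"
        using margin[OF i] by (auto simp: B_def)
      then show ?thesis
        using sq_dist_descent[OF w gt \<open>0 \<le> c\<close>] S drawn True by simp
    next
      case False
      then show ?thesis using sq_dist_Suc_le[OF w, of n] S True by simp
    qed
  qed
  have int_sq: "integrable M (\<lambda>w. indicat_real A w * sq_dist k w)" for k
    using integrable_mult_indicator[OF AM integrable_sq_dist] by simp
  have int_A: "integrable M (indicat_real A)"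
    using AM by (simp add: less_top[symmetric])
  have int_BJ: "integrable M (indicat_real (B i \<inter> J i))" if "i \<in> {1..m}" for i
    using BJ[OF that] by (simp add: less_top[symmetric])
  have int_S: "integrable M S"
    unfolding S_def using int_BJ by (intro Bochner_Integration.integrable_sum)
  have S_ge: "prob A / m \<le> (\<integral>w. S w \<partial>M)"
  proof -
    have "(\<integral>w. S w \<partial>M) = (\<Sum>i=1..m. \<integral>w. indicat_real (B i \<inter> J i) w \<partial>M)"
      unfolding S_def using int_BJ by (intro Bochner_Integration.integral_sum)
    also have "\<dots> = (\<Sum>i=1..m. prob (B i \<inter> J i))"
      using BJ by (intro sum.cong refl) simp
    finally show ?thesis using prob_BJ by simp
  qed
  have "(\<integral>w. indicat_real A w * sq_dist (Suc n) w \<partial>M)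
      \<le> (\<integral>w. indicat_real A w * sq_dist n w + indicat_real A w * (v n)\<^sup>2
             - 2 * v n * c * S w \<partial>M)"
    using int_sq int_A int_S pathwise
    by (intro integral_mono) (auto simp: distrib_left)
  also have "\<dots> = (\<integral>w. indicat_real A w * sq_dist n w \<partial>M) + prob A * (v n)\<^sup>2
      - 2 * v n * c * (\<integral>w. S w \<partial>M)"
    using int_sq int_A int_S AM by simp
  finally have main: "(\<integral>w. indicat_real A w * sq_dist (Suc n) w \<partial>M)
      \<le> (\<integral>w. indicat_real A w * sq_dist n w \<partial>M) + prob A * (v n)\<^sup>2
        - 2 * v n * c * (\<integral>w. S w \<partial>M)" .
  have "2 * (c / m * v n * prob A) = 2 * v n * c * (prob A / m)" by simp
  also have "\<dots> \<le> 2 * v n * c * (\<integral>w. S w \<partial>M)"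
    using S_ge v_pos[of n] \<open>0 \<le> c\<close> by (intro mult_left_mono) auto
  finally have gain: "2 * (c / m * v n * prob A) \<le> 2 * v n * c * (\<integral>w. S w \<partial>M)" .
  have "prob A * (v n)\<^sup>2 \<le> prob A * (v n * (c / m))"
    unfolding power2_eq_square using small_step v_pos[of n]
    by (intro mult_left_mono) auto
  also have "\<dots> = c / m * v n * prob A" by simp
  finally have loss: "prob A * (v n)\<^sup>2 \<le> c / m * v n * prob A" .
  have "a + q \<le> b" if "a \<le> b + s - t" "2 * q \<le> t" "s \<le> q" for a b q s t :: real
    using that by linarith
  from this[OF main gain loss] show ?thesis
    by (simp only: set_lebesgue_integral_def real_scaleR_def)
qed

lemma uniform_margin_exists:
  assumes "\<epsilon> > 0"
  obtains c where "c > 0" "\<And>i. i \<in> {1..m} \<Longrightarrow> L i * c powr p < \<epsilon> / m"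
proof -
  have "p > 0" using holder by (simp add: holder_condition_def)
  have "\<forall>\<^sub>F c in at_right 0. L i * c powr p < \<epsilon> / m" if "i \<in> {1..m}" for i
  proof -
    have "((\<lambda>c. L i * c powr p) \<longlongrightarrow> L i * 0 powr p) (at_right 0)"
      using \<open>p > 0\<close>
      by (intro tendsto_intros) (auto simp: eventually_at_right_less less_imp_le
          intro: eventually_mono[OF eventually_at_right_less])
    then show ?thesis
      using that \<open>\<epsilon> > 0\<close> by (auto intro: order_tendstoD)
  qed
  then have "\<forall>\<^sub>F c in at_right 0. \<forall>i\<in>{1..m}. L i * c powr p < \<epsilon> / m"
    by (intro eventually_ball_finite) auto
  then have "\<forall>\<^sub>F c in at_right 0. 0 < c \<and> (\<forall>i\<in>{1..m}. L i * c powr p < \<epsilon> / m)"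
    using eventually_at_right_less by (rule eventually_conj[rotated])
  from eventually_happens'[OF _ this] that show thesis
    by (auto simp: trivial_limit_at_right_real)
qed

text \<open>
  Telescoping the expected descent over the decreasing events \<open>A n\<close> bounds
  \<open>c / m * prob E * (\<Sum>k=N..<n. v k)\<close> by the integral of \<open>sq_dist N\<close> over \<open>A N\<close>, uniformly
  in \<open>n\<close>, where \<open>E\<close> is the intersection of the \<open>A n\<close>.
\<close>

lemma persistent_gap_null:
  assumes v_lim: "v \<longlonglongrightarrow> 0" and v_sum: "filterlim (\<lambda>n. \<Sum>k<n. v k) at_top sequentially"
    and "m \<ge> 1" and "\<epsilon> > 0"
  shows "AE w in M. \<not> (\<forall>\<^sub>F k in sequentially. sum_fun m f z + \<epsilon> \<le> sum_fun m f (x k w))"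
proof -
  obtain c where c: "c > 0" "\<And>i. i \<in> {1..m} \<Longrightarrow> L i * c powr p < \<epsilon> / m"
    using uniform_margin_exists[OF \<open>\<epsilon> > 0\<close>] by blast
  define \<kappa> where "\<kappa> = c / m"
  have \<kappa>: "0 < \<kappa>" using c(1) \<open>m \<ge> 1\<close> by (simp add: \<kappa>_def)
  from order_tendstoD(2)[OF v_lim \<kappa>] obtain K where K: "\<And>n. n \<ge> K \<Longrightarrow> v n < \<kappa>"
    by (auto simp: eventually_sequentially)
  note objective_measurable[measurable]
  have null: "AE w in M. \<not> (\<forall>k\<ge>N. sum_fun m f z + \<epsilon> \<le> sum_fun m f (x k w))" if "N \<ge> K" for N
  proof -
    define A where "A n = {w\<in>space M. \<forall>k\<in>{N..n}. sum_fun m f z + \<epsilon> \<le> sum_fun m f (x k w)}" for n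
    define E where "E = {w\<in>space M. \<forall>k\<ge>N. sum_fun m f z + \<epsilon> \<le> sum_fun m f (x k w)}"
    have A: "A n \<in> sets (F n)" for n
    proof -
      have "{w\<in>space (F n). sum_fun m f z + \<epsilon> \<le> sum_fun m f (x k w)} \<in> sets (F n)"
        if "k \<in> {N..n}" for k
      proof -
        have [measurable]: "x k \<in> borel_measurable (F n)"
          using that by (intro iterate_measurable_F) simp
        show ?thesis by measurable
      qed
      then have "{w\<in>space (F n). \<forall>k\<in>{N..n}. sum_fun m f z + \<epsilon> \<le> sum_fun m f (x k w)} \<in> sets (F n)"
        by (intro sets.sets_Collect_finite_All) auto
      then show ?thesis by (simp add: A_def space_F)
    qed
    then have AM: "A n \<in> sets M" for n using sets_F_subset by auto
    note iterate_measurable[measurable]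
    have E: "E \<in> sets M" unfolding E_def by measurable
    have telescope: "(LINT w:A n|M. sq_dist n w) + \<kappa> * prob E * (\<Sum>k=N..<n. v k)
        \<le> (LINT w:A N|M. sq_dist N w)" if "n \<ge> N" for n
      using that
    proof (induction n rule: dec_induct)
      case base
      then show ?case by simp
    next
      case (step n)
      have "(LINT w:A (Suc n)|M. sq_dist (Suc n) w) \<le> (LINT w:A n|M. sq_dist (Suc n) w)"
        using integrable_mult_indicator[OF AM integrable_sq_dist]
        unfolding set_lebesgue_integral_def
        by (intro integral_mono) (auto simp: A_def indicator_def)
      moreover have "(LINT w:A n|M. sq_dist (Suc n) w) + \<kappa> * v n * prob (A n)
          \<le> (LINT w:A n|M. sq_dist n w)"
        using c \<open>\<epsilon> > 0\<close> K[of n] step(1) \<open>N \<ge> K\<close>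
        unfolding \<kappa>_def
        by (intro expected_descent[OF A, where \<epsilon> = \<epsilon>]) (auto simp: A_def less_imp_le)
      moreover have "\<kappa> * v n * prob E \<le> \<kappa> * v n * prob (A n)"
      proof (intro mult_left_mono finite_measure_mono AM)
        show "E \<subseteq> A n" by (auto simp: A_def E_def)
        show "0 \<le> \<kappa> * v n" using mult_pos_pos[OF \<kappa> v_pos] by (rule less_imp_le)
      qed
      ultimately show ?case
        using step by (simp add: algebra_simps)
    qed
    have "prob E = 0"
    proof (rule ccontr)
      assume "prob E \<noteq> 0"
      then have q: "0 < \<kappa> * prob E"
        using \<kappa> by (simp add: zero_less_measure_iff)
      \<comment> \<open>A level of the partial sums beyond which the telescoped integral would be negative.\<close>
      define b where "b = (LINT w:A N|M. sq_dist N w) / (\<kappa> * prob E) + (\<Sum>k<N. v k)"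
      have "\<forall>\<^sub>F n in sequentially. b < (\<Sum>k<n. v k)"
        using v_sum by (simp add: filterlim_at_top_dense)
      then obtain n where n: "n \<ge> N" "b < (\<Sum>k<n. v k)"
        using eventually_happens'[OF _ eventually_conj[OF eventually_ge_at_top[of N]]] by force
      have "(\<Sum>k<n. v k) = (\<Sum>k<N. v k) + (\<Sum>k=N..<n. v k)"
        using n(1) sum.atLeastLessThan_concat[of 0 N n v] by (simp add: lessThan_atLeast0)
      with n(2) have "(LINT w:A N|M. sq_dist N w) / (\<kappa> * prob E) < (\<Sum>k=N..<n. v k)"
        by (simp add: b_def)
      then have "(LINT w:A N|M. sq_dist N w) < \<kappa> * prob E * (\<Sum>k=N..<n. v k)"
        using q by (simp add: pos_divide_less_eq mult.commute)
      moreover have "0 \<le> (LINT w:A n|M. sq_dist n w)"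
        unfolding set_lebesgue_integral_def by (intro integral_nonneg_AE) simp
      ultimately show False using telescope[OF n(1)] by linarith
    qed
    then have "E \<in> null_sets M" using E by (simp add: null_sets_def emeasure_eq_measure)
    then show ?thesis by (rule AE_I') (auto simp: E_def)
  qed
  have "AE w in M. \<forall>N. \<not> (\<forall>k\<ge>max K N. sum_fun m f z + \<epsilon> \<le> sum_fun m f (x k w))"
    unfolding AE_all_countable by (intro allI null) simp
  then show ?thesis
    by eventually_elim (auto simp: eventually_sequentially)
qed

end

lemma ereal_liminf_eqI:
  fixes u :: "nat \<Rightarrow> real"
  assumes lower: "\<And>k. a \<le> u k"
    and recurs: "\<And>j. \<not> (\<forall>\<^sub>F k in sequentially. a + inverse (real (Suc j)) \<le> u k)"
  shows "liminf (\<lambda>k. ereal (u k)) = ereal a"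
proof (rule antisym)
  show "ereal a \<le> liminf (\<lambda>k. ereal (u k))"
    using lower by (intro Liminf_bounded) simp
  show "liminf (\<lambda>k. ereal (u k)) \<le> ereal a"
  proof (rule ccontr)
    assume "\<not> ?thesis"
    then obtain b where b: "ereal a < ereal b" "ereal b < liminf (\<lambda>k. ereal (u k))"
      using ereal_dense2[of "ereal a" "liminf (\<lambda>k. ereal (u k))"] by (auto simp: not_le)
    then obtain j where "inverse (real (Suc j)) < b - a"
      using reals_Archimedean[of "b - a"] by auto
    then have "\<forall>\<^sub>F k in sequentially. a + inverse (real (Suc j)) \<le> u k"
      using less_LiminfD[OF b(2)] by (auto elim!: eventually_mono)
    with recurs show False by blast
  qed
qed

theorem theorem3p7:
  fixes X :: "(real ^ 'n) set"
    and f :: "nat \<Rightarrow> real ^ 'n \<Rightarrow> real"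
    and m :: nat
    and L :: "nat \<Rightarrow> real" and p :: real
    and v :: "nat \<Rightarrow> real"
    and M :: "'w measure" and F :: "nat \<Rightarrow> 'w measure"
    and x0 :: "real ^ 'n"
    and x g :: "nat \<Rightarrow> 'w \<Rightarrow> real ^ 'n"
    and \<omega> :: "nat \<Rightarrow> 'w \<Rightarrow> nat"
  assumes "X \<noteq> {}" and "closed X" and "convex X"
    and "m \<ge> 1"
    and "\<And>i. i \<in> {1..m} \<Longrightarrow> continuous_on UNIV (f i)"
    and "\<And>i. i \<in> {1..m} \<Longrightarrow> quasi_convex (f i)"
    and common_solution: "(\<Inter>i\<in>{1..m}. argmin_set (f i) X) \<noteq> {}"
    and "holder_condition m f X L p"
    and "\<And>k. v k > 0" and "v \<longlonglongrightarrow> 0"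
    and "filterlim (\<lambda>n. \<Sum>k<n. v k) at_top sequentially"
    and "randomized_incremental_subgradient M F m f X v x0 x \<omega> g"
    \<comment> \<open>Automatic for x0 in X. For an infeasible x0 with a value below the minimum over X the
        method stops at once and yields no sequence.\<close>
    and "min_value (sum_fun m f) X \<le> sum_fun m f x0"
  shows "AE w in M. liminf (\<lambda>k. ereal (sum_fun m f (x k w)))
                      = ereal (min_value (sum_fun m f) X)"
proof -
  from common_solution obtain z where z: "\<And>i. i \<in> {1..m} \<Longrightarrow> z \<in> argmin_set (f i) X"
    by blast
  have "z \<in> X" using z[of 1] \<open>m \<ge> 1\<close> by (simp add: argmin_set_def is_arg_min_def)
  interpret randomized_incremental_subgradient M F m f X v x0 x \<omega> g by fact
  interpret subgradient_run_with_common_minimizer M F m f X v x0 x \<omega> g L p z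
    using assms \<open>z \<in> X\<close> z
    by unfold_locales (auto simp: argmin_set_def is_arg_min_def not_less)
  have "AE w in M. \<forall>j. \<not> (\<forall>\<^sub>F k in sequentially.
          sum_fun m f z + inverse (real (Suc j)) \<le> sum_fun m f (x k w))"
    unfolding AE_all_countable using assms by (intro allI persistent_gap_null) auto
  then show ?thesis
    using AE_space unfolding min_value_objective
    by eventually_elim (intro ereal_liminf_eqI objective_ge_min, auto)
qed

end
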